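(* Let $(\mathcal{X},d)$ be a complete metric space, let $f\colon\mathcal{X}\to\mathbb{R}\cup\{+\infty\}$ be a closed function, and let $x\in\mathcal{X}$ be a point with $f(x)$ finite. Let $f_x\colon\mathcal{X}\to\mathbb{R}\cup\{+\infty\}$ be a closed function such that $$|f_x(y)-f(y)|\leq \omega(d(x,y))\quad\text{for all } y\in\mathcal{X},$$ where $\omega$ is some growth function, and let $x^+$ be a minimizer of $f_x$. If $x^+=x$, then $|\nabla f|(x)=0$. If $x^+\neq x$, then there exists a point $\hat x\in\mathcal{X}$ satisfying 1. (point proximity) $d(x^+,\hat x)\leq 2\cdot\frac{\omega(d(x^+,x))}{\omega'(d(x^+,x))}$, 2. (value proximity) $f(\hat x)\leq f(x^+)+\omega(d(x^+,x))$, 3. (near-stationarity) $|\nabla f|(\hat x)\leq \omega'(d(x^+,x))+\omega'(d(\hat x,x))$.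
   Context: A function on a metric space is called closed if it is lower-semicontinuous. A growth function is a differentiable function $\omega\colon[0,\infty)\to[0,\infty)$ (one-sided derivative at $0$) with $\omega(0)=\omega'(0)=0$ and $\omega'>0$ on $(0,\infty)$. The slope of $f$ at a point $\bar x$ with $f(\bar x)$ finite is $|\nabla f|(\bar x):=\limsup_{x\to\bar x,\,x\ne\bar x}\frac{(f(\bar x)-f(x))^+}{d(\bar x,x)}$, where $r^+=\max\{0,r\}$ (it is $0$ if $\bar x$ is isolated); by convention $|\nabla f|(\bar x)=+\infty$ where $f(\bar x)=+\infty$. The inequality $|f_x(y)-f(y)|\le\omega(d(x,y))$ is understood to mean that $f_x(y)$ and $f(y)$ are either both $+\infty$ or both finite and satisfying the inequality. *)

theory Defs
  imports "HOL-Analysis.Analysis"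
begin

(* Functions into the reals with +infinity are represented as ereal-valued functions that avoid
   -infinity. *)
definition extended_valued :: "('a \<Rightarrow> ereal) \<Rightarrow> bool" where
  "extended_valued f \<longleftrightarrow> (\<forall>y. f y \<noteq> -\<infinity>)"

(* At an isolated point the condition holds trivially, since Liminf bot f = \<infinity>. *)
definition lower_semicontinuous :: "('a::topological_space \<Rightarrow> ereal) \<Rightarrow> bool" where
  "lower_semicontinuous f \<longleftrightarrow> (\<forall>x. f x \<le> Liminf (at x) f)"

(* \<omega> lives on [0,\<infinity>); its values and those of \<omega>' on the negative reals are irrelevant.  On the
   half-line the derivative is unique, so \<omega>' is determined there by \<omega>; the filter
   "at t within {0..}" makes it one-sided at 0 and two-sided at t > 0. *)
definition growth_function :: "(real \<Rightarrow> real) \<Rightarrow> (real \<Rightarrow> real) \<Rightarrow> bool" where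
  "growth_function \<omega> \<omega>' \<longleftrightarrow>
     (\<forall>t\<ge>0. 0 \<le> \<omega> t) \<and>
     (\<forall>t\<ge>0. (\<omega> has_real_derivative \<omega>' t) (at t within {0..})) \<and>
     \<omega> 0 = 0 \<and> \<omega>' 0 = 0 \<and> (\<forall>t>0. 0 < \<omega>' t)"

(* The isolated case is separate because Limsup bot of an ereal function is -\<infinity>. *)
definition slope :: "('a::metric_space \<Rightarrow> ereal) \<Rightarrow> 'a \<Rightarrow> ereal" where
  "slope f x =
     (if f x = \<infinity> then \<infinity>
      else if at x = bot then 0
      else Limsup (at x) (\<lambda>y. max 0 (f x - f y) / ereal (dist x y)))"

(* The bound on the absolute difference, read so that \<infinity> - \<infinity> never occurs. *)
definition abs_diff_le :: "ereal \<Rightarrow> ereal \<Rightarrow> real \<Rightarrow> bool" where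
  "abs_diff_le a b r \<longleftrightarrow>
     (a = \<infinity> \<and> b = \<infinity>) \<or> (\<bar>a\<bar> \<noteq> \<infinity> \<and> \<bar>b\<bar> \<noteq> \<infinity> \<and> \<bar>a - b\<bar> \<le> ereal r)"

end

theory Submission
  imports Defs
begin

text \<open>
  The perturbed function \<open>g y = f y + \<omega> (dist x y)\<close> dominates \<open>fx\<close>, so its infimum is at
  least \<open>fx xp\<close>, whereas \<open>g xp\<close> exceeds \<open>fx xp\<close> by at most \<open>2 * \<omega> (dist xp x)\<close>.
  Ekeland's variational principle for \<open>g\<close> at \<open>xp\<close> with constant \<open>\<omega>' (dist xp x)\<close>
  gives a point \<open>xh\<close> near \<open>xp\<close> that minimizes \<open>g y + \<omega>' (dist xp x) * dist xh y\<close>.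
  Differentiability of \<open>\<omega>\<close> at \<open>dist xh x\<close> alone then bounds the slope of \<open>f\<close> at \<open>xh\<close>.
\<close>

lemma lower_semicontinuous_add_continuous:
  fixes g :: "'a::topological_space \<Rightarrow> ereal"
  assumes g: "lower_semicontinuous g" and w: "continuous_on UNIV w"
  shows "lower_semicontinuous (\<lambda>y. g y + ereal (w y))"
  unfolding lower_semicontinuous_def le_Liminf_iff
proof (intro allI impI)
  fix x C assume C: "C < g x + ereal (w x)"
  \<comment> \<open>A real \<open>r\<close> strictly between the two sides splits the estimate: near
    \<open>x\<close>, lower semicontinuity keeps \<open>g\<close> above \<open>r\<close>, and
    continuity keeps \<open>r + w\<close> above \<open>C\<close>. The infinite values of
    \<open>C\<close> and \<open>g x\<close> thus need no separate treatment.\<close>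
  have "C - ereal (w x) < g x"
    using C by (cases C; cases "g x") auto
  then obtain r where r: "C - ereal (w x) < ereal r" "ereal r < g x"
    using ereal_dense2 by blast
  have 1: "eventually (\<lambda>y. ereal r < g y) (at x)"
    using g r(2) unfolding lower_semicontinuous_def le_Liminf_iff by blast
  have "(w \<longlongrightarrow> w x) (at x)" using w by (simp add: continuous_on_def)
  hence lim: "((\<lambda>y. ereal (r + w y)) \<longlongrightarrow> ereal (r + w x)) (at x)"
    by (intro tendsto_intros)
  have "C < ereal (r + w x)" using r(1) by (cases C) auto
  from order_tendstoD(1)[OF lim this]
  have 2: "eventually (\<lambda>y. C < ereal (r + w y)) (at x)" .
  from 1 2 show "eventually (\<lambda>y. C < g y + ereal (w y)) (at x)"
  proof eventually_elim
    case (elim y)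
    have "ereal (r + w y) \<le> g y + ereal (w y)" using elim(1) by (cases "g y") auto
    with elim(2) show ?case by order
  qed
qed

lemma closed_sublevel:
  fixes g :: "'a::topological_space \<Rightarrow> ereal"
  assumes "lower_semicontinuous g"
  shows "closed {y. g y \<le> C}"
proof -
  have "open {y. C < g y}"
  proof (subst open_subopen, safe)
    fix x assume x: "C < g x"
    have "eventually (\<lambda>y. C < g y) (at x)"
      using assms x unfolding lower_semicontinuous_def le_Liminf_iff by blast
    \<comment> \<open>Lower semicontinuity speaks of punctured neighbourhoods only; the assumption
      at \<open>x\<close> itself fills the hole.\<close>
    with x have "eventually (\<lambda>y. C < g y) (nhds x)"
      by (auto simp: eventually_at_filter elim: eventually_mono)
    thus "\<exists>T. open T \<and> x \<in> T \<and> T \<subseteq> {y. C < g y}"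
      unfolding eventually_nhds by blast
  qed
  moreover have "- {y. g y \<le> C} = {y. C < g y}" by auto
  ultimately show ?thesis by (simp add: closed_def)
qed

text \<open>The sets \<open>S z\<close> of points that improve on \<open>z\<close> by at least
  \<open>c\<close> times the distance are the lower sections of a preorder. Moving repeatedly to a
  near-minimizer of \<open>g\<close> on the current section makes the sections shrink to one point,
  and nothing lies below that point except itself.\<close>

lemma ekeland_variational_principle:
  fixes g :: "'a::complete_space \<Rightarrow> ereal"
  assumes lsc: "lower_semicontinuous g" and bdd: "\<And>y. ereal m \<le> g y"
    and a: "g a \<noteq> \<infinity>" and c: "0 < c"
  obtains z where "g z + ereal (c * dist a z) \<le> g a"
    and "\<And>y. y \<noteq> z \<Longrightarrow> g z < g y + ereal (c * dist z y)"
proof -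
  define S where "S z = {y. g y + ereal (c * dist z y) \<le> g z}" for z
  have S_self: "z \<in> S z" for z by (simp add: S_def)
  have S_closed: "closed (S z)" for z
    unfolding S_def
    by (intro closed_sublevel lower_semicontinuous_add_continuous lsc continuous_intros)
  have S_fin: "g y \<noteq> \<infinity>" if "y \<in> S z" "g z \<noteq> \<infinity>" for y z
    using that by (auto simp: S_def)
  have ninf: "g y \<noteq> -\<infinity>" for y using bdd[of y] by auto
  have S_trans: "y \<in> S v" if "y \<in> S z" "z \<in> S v" for y z v
  proof -
    have "c * dist v y \<le> c * dist v z + c * dist z y"
      using c dist_triangle[of v y z] by (simp flip: distrib_left)
    with that ninf[of y] ninf[of z] ninf[of v] show ?thesis
      unfolding S_def mem_Collect_eq
      by (cases "g y"; cases "g z"; cases "g v") auto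
  qed
  \<comment> \<open>The infimum over \<open>S z\<close> is finite, since it lies between
    \<open>m\<close> and \<open>g z\<close>, but it need not be attained; hence the slack.\<close>
  have step: "\<exists>y. g y \<noteq> \<infinity> \<and> y \<in> S z \<and> (\<forall>u\<in>S z. g y \<le> g u + ereal ((1/2)^n))"
    if z: "g z \<noteq> \<infinity>" for z and n :: nat
  proof -
    define I where "I = Inf (g ` S z)"
    have "ereal m \<le> I" unfolding I_def by (intro Inf_greatest) (auto intro: bdd)
    moreover have "I \<le> g z" unfolding I_def by (intro INF_lower S_self)
    ultimately obtain i where i: "I = ereal i" using z by (cases I) auto
    have "I < ereal (i + (1/2)^n)" by (simp add: i)
    then obtain y where y: "y \<in> S z" "g y < ereal (i + (1/2)^n)"
      unfolding I_def Inf_less_iff by auto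
    have "g y \<le> g u + ereal ((1/2)^n)" if "u \<in> S z" for u
    proof -
      have "ereal i \<le> g u" unfolding i[symmetric] I_def using that by (rule INF_lower)
      hence "ereal (i + (1/2)^n) \<le> g u + ereal ((1/2)^n)" by (cases "g u") auto
      with y(2) show ?thesis by order
    qed
    with y S_fin z show ?thesis by blast
  qed
  obtain u where u_fin: "\<And>n. g (u n) \<noteq> \<infinity>" and u0: "u 0 = a"
    and u_in: "\<And>n. u (Suc n) \<in> S (u n)"
    and u_min: "\<And>n v. v \<in> S (u n) \<Longrightarrow> g (u (Suc n)) \<le> g v + ereal ((1/2)^n)"
  proof -
    \<comment> \<open>Finiteness is part of the invariant because \<open>step\<close> requires it;
      the clause for \<open>n = 0\<close> pins the start to \<open>a\<close>.\<close>
    let ?P = "\<lambda>n z. g z \<noteq> \<infinity> \<and> ((n::nat) = 0 \<longrightarrow> z = a)"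
    let ?Q = "\<lambda>n z y. y \<in> S z \<and> (\<forall>v\<in>S z. g y \<le> g v + ereal ((1/2)^n))"
    have "\<exists>u. \<forall>n. ?P n (u n) \<and> ?Q n (u n) (u (Suc n))"
    proof (rule dependent_nat_choice)
      show "\<exists>z. ?P 0 z" using a by auto
      show "\<exists>y. ?P (Suc n) y \<and> ?Q n z y" if "?P n z" for z n
        using step[of z n] that by auto
    qed
    then show ?thesis using that by blast
  qed
  \<comment> \<open>By transitivity \<open>v\<close> also lies in \<open>S (u n)\<close>, where
    \<open>u (Suc n)\<close> is minimal up to \<open>(1/2)^n\<close>. So \<open>v\<close> cannot
    lower the value by more than that, while membership in \<open>S (u (Suc n))\<close> forces a
    drop of \<open>c\<close> times the distance.\<close>
  have near: "c * dist (u (Suc n)) v \<le> (1/2)^n" if v: "v \<in> S (u (Suc n))" for n v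
    using v u_min[OF S_trans[OF v u_in]] u_fin[of "Suc n"] ninf[of v] ninf[of "u (Suc n)"]
    unfolding S_def mem_Collect_eq
    by (cases "g v"; cases "g (u (Suc n))") auto
  have decr: "S (u n) \<subseteq> S (u k)" if "k \<le> n" for k n
    by (rule lift_Suc_antimono_le[of "\<lambda>n. S (u n)", OF _ that]) (use S_trans u_in in blast)
  have small: "\<exists>n. \<forall>v\<in>S (u n). \<forall>w\<in>S (u n). dist v w < e" if e: "0 < e" for e :: real
  proof -
    obtain n where n: "(1/2)^n < c * e / 2"
      using real_arch_pow_inv[of "c * e / 2" "1/2"] c e by auto
    have "dist v w < e" if "v \<in> S (u (Suc n))" "w \<in> S (u (Suc n))" for v w
    proof -
      have "c * dist v w \<le> c * dist (u (Suc n)) v + c * dist (u (Suc n)) w"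
        using c dist_triangle3[of v w "u (Suc n)"] by (simp flip: distrib_left)
      also have "\<dots> < c * e" using near[OF that(1)] near[OF that(2)] n by linarith
      finally show ?thesis using c by simp
    qed
    thus ?thesis by blast
  qed
  \<comment> \<open>Cantor's intersection theorem; completeness enters here.\<close>
  have "\<exists>z. \<Inter>(range (\<lambda>n. S (u n))) = {z}"
    by (rule decreasing_closed_nest_sing) (use S_closed S_self decr small in blast)+
  then obtain z where z: "(\<Inter>n. S (u n)) = {z}" by blast
  hence z_in: "z \<in> S (u n)" for n by blast
  show thesis
  proof
    show "g z + ereal (c * dist a z) \<le> g a" using z_in[of 0] by (simp add: S_def u0)
    show "g z < g y + ereal (c * dist z y)" if "y \<noteq> z" for y
    proof (rule ccontr)
      assume "\<not> ?thesis"
      \<comment> \<open>A violating \<open>y\<close> lies below \<open>z\<close>, hence by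
        transitivity in every \<open>S (u n)\<close>, and so coincides with
        \<open>z\<close>.\<close>
      hence "y \<in> S z" by (simp add: S_def)
      hence "y \<in> (\<Inter>n. S (u n))" using S_trans z_in by blast
      with z that show False by simp
    qed
  qed
qed

lemma growth_function_deriv_nonneg:
  assumes "growth_function \<omega> \<omega>'" and "0 \<le> t"
  shows "0 \<le> \<omega>' t"
  using assms unfolding growth_function_def by (cases "t = 0") (auto intro: less_imp_le)

lemma growth_function_continuous_dist:
  fixes x :: "'a::metric_space"
  assumes "growth_function \<omega> \<omega>'"
  shows "continuous_on UNIV (\<lambda>y. \<omega> (dist x y))"
proof -
  have "continuous_on {0..} \<omega>"
    using assms unfolding growth_function_def
    by (intro DERIV_continuous_on) auto
  moreover have "continuous_on UNIV (dist x)" by (intro continuous_intros)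
  ultimately show ?thesis by (rule continuous_on_compose2) auto
qed

lemma slope_nonneg: "0 \<le> slope f x"
proof (cases "f x = \<infinity> \<or> at x = bot")
  case False
  have "0 \<le> Limsup (at x) (\<lambda>y. max 0 (f x - f y) / ereal (dist x y))"
    using False by (intro le_Limsup always_eventually) (auto intro!: zero_le_divide_ereal)
  with False show ?thesis by (simp add: slope_def)
qed (auto simp: slope_def)

text \<open>With \<open>t = dist x z\<close>, the growth of \<open>\<omega> (dist x y)\<close> over
  \<open>\<omega> t\<close> is at most \<open>(\<omega>' t + e) * dist z y\<close> for
  \<open>y\<close> near \<open>z\<close>, because distances to \<open>x\<close> change by at most
  \<open>dist z y\<close>. Minimality turns this into a bound on the difference quotient of
  \<open>f\<close>. Allowing \<open>c = 0\<close> covers the case where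
  \<open>xp = x\<close>.\<close>

lemma slope_le_of_perturbed_minimizer:
  fixes f :: "'a::metric_space \<Rightarrow> ereal"
  assumes gf: "growth_function \<omega> \<omega>'" and f: "extended_valued f" and fz: "f z \<noteq> \<infinity>"
    and c: "0 \<le> c"
    and min: "\<And>y. f z + ereal (\<omega> (dist x z)) \<le> f y + ereal (\<omega> (dist x y)) + ereal (c * dist z y)"
  shows "slope f z \<le> ereal (c + \<omega>' (dist z x))"
proof (cases "at z = bot")
  case True
  then show ?thesis using fz c growth_function_deriv_nonneg[OF gf] by (simp add: slope_def)
next
  case False
  define t where "t = dist x z"
  have wt: "0 \<le> \<omega>' t" by (simp add: growth_function_deriv_nonneg[OF gf] t_def)
  obtain F where F: "f z = ereal F"
    using f fz unfolding extended_valued_def by (cases "f z") auto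
  have "Limsup (at z) (\<lambda>y. max 0 (f z - f y) / ereal (dist z y)) \<le> ereal (c + \<omega>' t) + ereal e"
    if e: "0 < e" for e :: real
  proof (rule Limsup_bounded)
    \<comment> \<open>The derivative within \<open>{0..}\<close> suffices even for
      \<open>t = 0\<close>, since only distances are inserted for \<open>s\<close>.\<close>
    have "(\<omega> has_derivative (*) (\<omega>' t)) (at t within {0..})"
      using gf unfolding growth_function_def has_field_derivative_def by (simp add: t_def)
    then obtain d where d: "0 < d"
      and d': "\<forall>s\<in>{0..}. norm (s - t) < d \<longrightarrow>
        norm (\<omega> s - \<omega> t - \<omega>' t * (s - t)) \<le> e * norm (s - t)"
      unfolding has_derivative_within_alt using e by blast
    have D: "\<bar>\<omega> s - \<omega> t - \<omega>' t * (s - t)\<bar> \<le> e * \<bar>s - t\<bar>"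
      if "0 \<le> s" "\<bar>s - t\<bar> < d" for s
      using d'[rule_format, of s] that unfolding real_norm_def atLeast_iff by blast
    have "max 0 (f z - f y) / ereal (dist z y) \<le> ereal (c + \<omega>' t) + ereal e"
      if y: "y \<noteq> z" "dist y z < d" for y
    proof (cases "f y")
      case (real G)
      define s where "s = dist x y"
      have st: "\<bar>s - t\<bar> \<le> dist z y"
        unfolding s_def t_def
        using dist_triangle[of x y z] dist_triangle[of x z y] by (simp add: dist_commute)
      have "\<omega>' t * (s - t) \<le> \<omega>' t * dist z y" using st wt by (intro mult_left_mono) auto
      moreover have "e * \<bar>s - t\<bar> \<le> e * dist z y" using st e by (intro mult_left_mono) auto
      moreover have "\<bar>\<omega> s - \<omega> t - \<omega>' t * (s - t)\<bar> \<le> e * \<bar>s - t\<bar>"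
        using st y by (intro D) (auto simp: s_def dist_commute)
      moreover have "F + \<omega> t \<le> G + \<omega> s + c * dist z y"
        using min[of y] by (simp add: F real s_def t_def)
      ultimately have "F - G \<le> (c + \<omega>' t + e) * dist z y"
        by (simp add: algebra_simps)
      \<comment> \<open>This handles the truncation by \<open>max 0\<close> in the slope.\<close>
      moreover have "0 \<le> (c + \<omega>' t + e) * dist z y" using c wt e by simp
      ultimately have "max 0 (F - G) / dist z y \<le> c + \<omega>' t + e"
        using y by (simp add: divide_le_eq)
      thus ?thesis using y by (simp add: F real max_def split: if_splits)
    next
      case PInf
      then show ?thesis using c wt e by (simp add: F)
    next
      case MInf
      then show ?thesis using f unfolding extended_valued_def by blast
    qed
    then show "eventually (\<lambda>y. max 0 (f z - f y) / ereal (dist z y) \<le> ereal (c + \<omega>' t) + ereal e) (at z)"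
      unfolding eventually_at using d by blast
  qed
  hence "Limsup (at z) (\<lambda>y. max 0 (f z - f y) / ereal (dist z y)) \<le> ereal (c + \<omega>' t)"
    by (rule ereal_le_epsilon2)
  then show ?thesis using False fz by (simp add: slope_def t_def dist_commute)
qed

theorem theorem3p1:
  fixes f fx :: "'a::complete_space \<Rightarrow> ereal"
    and x xp :: 'a
    and \<omega> \<omega>' :: "real \<Rightarrow> real"
  assumes "extended_valued f" and "lower_semicontinuous f"
    and "f x \<noteq> \<infinity>"
    and "extended_valued fx" and "lower_semicontinuous fx"
    and "growth_function \<omega> \<omega>'"
    and "\<And>y. abs_diff_le (fx y) (f y) (\<omega> (dist x y))"
    and "\<And>y. fx xp \<le> fx y"
  shows "(xp = x \<longrightarrow> slope f x = 0) \<and>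
    (xp \<noteq> x \<longrightarrow>
      (\<exists>xh. dist xp xh \<le> 2 * (\<omega> (dist xp x) / \<omega>' (dist xp x)) \<and>
            f xh \<le> f xp + ereal (\<omega> (dist xp x)) \<and>
            slope f xh \<le> ereal (\<omega>' (dist xp x) + \<omega>' (dist xh x))))"
proof -
  define g where "g y = f y + ereal (\<omega> (dist x y))" for y
  have w0: "\<omega> 0 = 0" "\<omega>' 0 = 0" and wpos: "\<And>t. 0 \<le> t \<Longrightarrow> 0 \<le> \<omega> t"
    and w'pos: "\<And>t. 0 < t \<Longrightarrow> 0 < \<omega>' t"
    using assms(6) unfolding growth_function_def by auto
  have fx_le_g: "fx y \<le> g y" for y
    using assms(7)[of y] unfolding abs_diff_le_def g_def
    by (cases "fx y"; cases "f y") auto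
  have f_le_fx: "f y \<le> fx y + ereal (\<omega> (dist x y))" for y
    using assms(7)[of y] unfolding abs_diff_le_def
    by (cases "fx y"; cases "f y") auto
  have "fx x \<noteq> \<infinity>" using assms(3) assms(7)[of x] unfolding abs_diff_le_def by auto
  then obtain m where m: "fx xp = ereal m"
    using assms(4) assms(8)[of x] unfolding extended_valued_def by (cases "fx xp") auto
  have g_bdd: "ereal m \<le> g y" for y
    using assms(8)[of y] fx_le_g[of y] m by order
  obtain F where F: "f xp = ereal F" "F \<le> m + \<omega> (dist x xp)"
    using f_le_fx[of xp] assms(1) m unfolding extended_valued_def
    by (cases "f xp") auto
  show ?thesis
  proof (intro conjI impI)
    assume "xp = x"
    \<comment> \<open>Here \<open>\<omega> (dist x xp) = 0\<close>, so
      \<open>g x = f x \<le> m\<close>: the point \<open>x\<close> itself minimizes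
      \<open>g\<close>, and no penalty term is needed.\<close>
    have "slope f x \<le> ereal (0 + \<omega>' (dist x x))"
    proof (rule slope_le_of_perturbed_minimizer[OF assms(6) assms(1,3), of _ x])
      fix y
      show "f x + ereal (\<omega> (dist x x)) \<le> f y + ereal (\<omega> (dist x y)) + ereal (0 * dist x y)"
        using g_bdd[of y] F unfolding g_def \<open>xp = x\<close>
        by (cases "f y") (auto simp: w0)
    qed simp
    thus "slope f x = 0" using slope_nonneg[of f x] by (simp add: w0 antisym flip: zero_ereal_def)
  next
    assume "xp \<noteq> x"
    \<comment> \<open>This constant turns the distance bound
      \<open>2 * \<omega> (dist xp x) / c\<close> and the slope bound
      \<open>c + \<omega>' (dist z x)\<close> into the claimed ones.\<close>
    define c where "c = \<omega>' (dist xp x)"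
    have c: "0 < c" using \<open>xp \<noteq> x\<close> by (simp add: c_def w'pos)
    have "lower_semicontinuous g"
      unfolding g_def
      by (intro lower_semicontinuous_add_continuous assms(2) growth_function_continuous_dist[OF assms(6)])
    moreover have "g xp \<noteq> \<infinity>" by (simp add: g_def F)
    ultimately obtain z where z: "g z + ereal (c * dist xp z) \<le> g xp"
      and z_min: "\<And>y. y \<noteq> z \<Longrightarrow> g z < g y + ereal (c * dist z y)"
      using ekeland_variational_principle[where g = g and m = m and a = xp and c = c, OF _ g_bdd _ c] by blast
    obtain G where G: "f z = ereal G"
      using z assms(1) unfolding extended_valued_def g_def F by (cases "f z") auto
    have descent: "G + \<omega> (dist x z) + c * dist xp z \<le> F + \<omega> (dist x xp)"
      using z by (simp add: g_def F G)
    \<comment> \<open>The drop of \<open>g\<close> from \<open>xp\<close> to \<open>z\<close> is at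
      least \<open>c * dist xp z\<close>, yet at most \<open>2 * \<omega> (dist xp x)\<close>: one
      \<open>\<omega>\<close> from \<open>F \<le> m + \<omega> (dist x xp)\<close>, one from the
      perturbation in \<open>g xp\<close>.\<close>
    have "m \<le> G + \<omega> (dist x z)" using g_bdd[of z] by (simp add: g_def G)
    hence "c * dist xp z \<le> 2 * \<omega> (dist xp x)"
      using descent F(2) by (simp add: dist_commute)
    hence "dist xp z \<le> 2 * (\<omega> (dist xp x) / c)"
      using c by (simp add: field_simps)
    \<comment> \<open>Value proximity follows by dropping these nonnegative terms from
      \<open>descent\<close>.\<close>
    moreover have "0 \<le> \<omega> (dist x z) + c * dist xp z" using c by (simp add: wpos)
    with descent have "f z \<le> f xp + ereal (\<omega> (dist xp x))"
      by (simp add: F G dist_commute)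
    moreover have "slope f z \<le> ereal (c + \<omega>' (dist z x))"
    proof (rule slope_le_of_perturbed_minimizer[OF assms(6) assms(1)])
      show "f z + ereal (\<omega> (dist x z)) \<le> f y + ereal (\<omega> (dist x y)) + ereal (c * dist z y)" for y
        using z_min[of y] unfolding g_def by (cases "y = z") auto
    qed (use c G in auto)
    ultimately show "\<exists>xh. dist xp xh \<le> 2 * (\<omega> (dist xp x) / \<omega>' (dist xp x)) \<and>
            f xh \<le> f xp + ereal (\<omega> (dist xp x)) \<and>
            slope f xh \<le> ereal (\<omega>' (dist xp x) + \<omega>' (dist xh x))"
      unfolding c_def by blast
  qed
qed

end
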